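(* The monoid $\mathbb{M}$ of Kuratowski operations contains exactly $118 = 2\cdot 57+4$ semigroups (nonempty subsets closed under composition), namely: exactly $57$ semigroups contained in $\langle\sigma_3,\sigma_4\rangle=\{\sigma_2,\sigma_3,\ldots,\sigma_{13}\}$; the $57$ monoids obtained by adding $\sigma_0$ to a semigroup contained in $\langle\sigma_3,\sigma_4\rangle$; the groups $\langle\sigma_0\rangle$ and $\langle\sigma_1\rangle$; and the monoids $\mathbb{M}_1=\langle\sigma_1,\sigma_6\rangle$ and $\mathbb{M}=\langle\sigma_1,\sigma_2\rangle$. These $118$ semigroups fall into exactly $56$ isomorphism types of semigroups: $28$ isomorphism types of semigroups contained in $\langle\sigma_3,\sigma_4\rangle$; $26$ further isomorphism types of monoids obtained by adding $\sigma_0$ to a semigroup contained in $\langle\sigma_3,\sigma_4\rangle$; and the types of $\mathbb{M}_1$ and $\mathbb{M}$.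
   Context: The monoid $\mathbb{M}$ of all Kuratowski operations is the monoid with identity $\sigma_0$ generated by $\sigma_1$ (complement) and $\sigma_2$ (closure) subject to the relations $\sigma_1\circ\sigma_1=\sigma_0$, $\sigma_2\circ\sigma_2=\sigma_2$, $\sigma_2\circ\sigma_{12}=\sigma_6$, $\sigma_2\circ\sigma_{13}=\sigma_7$, where (writing products as compositions, the rightmost factor applied first) $\sigma_3=\sigma_2\sigma_1$, $\sigma_4=\sigma_1\sigma_2$, $\sigma_5=\sigma_1\sigma_2\sigma_1$, $\sigma_6=\sigma_2\sigma_1\sigma_2$, $\sigma_7=\sigma_2\sigma_1\sigma_2\sigma_1$, $\sigma_8=\sigma_1\sigma_2\sigma_1\sigma_2$, $\sigma_9=\sigma_1\sigma_2\sigma_1\sigma_2\sigma_1$, $\sigma_{10}=\sigma_2\sigma_1\sigma_2\sigma_1\sigma_2$, $\sigma_{11}=\sigma_2\sigma_1\sigma_2\sigma_1\sigma_2\sigma_1$, $\sigma_{12}=\sigma_1\sigma_2\sigma_1\sigma_2\sigma_1\sigma_2$, $\sigma_{13}=\sigma_1\sigma_2\sigma_1\sigma_2\sigma_1\sigma_2\sigma_1$. It has exactly the $14$ distinct elements $\sigma_0,\sigma_1,\ldots,\sigma_{13}$. For elements $A,B,\ldots$ of $\mathbb{M}$, $\langle A,B,\ldots\rangle$ denotes the subsemigroup of $\mathbb{M}$ generated by them under composition. Isomorphism means isomorphism of semigroups. A semigroup contained in $\mathbb{M}$ counts as a monoid if it has its own two-sided identity (not necessarily $\sigma_0$). *)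

theory Defs
  imports "HOL-Algebra.Group"
begin

datatype generator = Compl | Clos

text \<open>
  The monoid of Kuratowski operations is the quotient of the free monoid on two generators
  by the least congruence containing the four defining relations.  A word \<open>[x, y, z]\<close> stands
  for the composition in which \<open>z\<close> is applied first.
\<close>

inductive kur_cong :: "generator list \<Rightarrow> generator list \<Rightarrow> bool" where
  compl_compl: "kur_cong ([Compl] @ [Compl]) []"
| clos_clos: "kur_cong ([Clos] @ [Clos]) [Clos]"
| clos_sigma12: "kur_cong ([Clos] @ [Compl, Clos, Compl, Clos, Compl, Clos]) [Clos, Compl, Clos]"
| clos_sigma13: "kur_cong ([Clos] @ [Compl, Clos, Compl, Clos, Compl, Clos, Compl])
    [Clos, Compl, Clos, Compl]"
| refl: "kur_cong u u"
| sym: "kur_cong u v \<Longrightarrow> kur_cong v u"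
| trans: "kur_cong u v \<Longrightarrow> kur_cong v w \<Longrightarrow> kur_cong u w"
| append: "kur_cong u u' \<Longrightarrow> kur_cong v v' \<Longrightarrow> kur_cong (u @ v) (u' @ v')"

quotient_type kuratowski = "generator list" / kur_cong
proof (rule equivpI)
  show "reflp kur_cong" by (rule reflpI) (rule kur_cong.refl)
  show "symp kur_cong" by (rule sympI) (rule kur_cong.sym)
  show "transp kur_cong" by (rule transpI) (rule kur_cong.trans)
qed

instantiation kuratowski :: monoid_mult
begin

lift_definition one_kuratowski :: kuratowski is "[]" .

lift_definition times_kuratowski :: "kuratowski \<Rightarrow> kuratowski \<Rightarrow> kuratowski" is "(@)"
  by (rule kur_cong.append)

instance
  by standard (transfer; simp add: kur_cong.refl)+

end

lift_definition compl_op :: kuratowski is "[Compl]" .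
lift_definition clos_op :: kuratowski is "[Clos]" .

text \<open>Only the values \<open>\<sigma> i\<close> for \<open>i \<le> 13\<close> are meaningful.\<close>

definition \<sigma> :: "nat \<Rightarrow> kuratowski" where
  "\<sigma> i = (let c = compl_op; k = clos_op in
    [1, c, k, k * c, c * k, c * k * c, k * c * k, k * c * k * c, c * k * c * k,
     c * k * c * k * c, k * c * k * c * k, k * c * k * c * k * c,
     c * k * c * k * c * k, c * k * c * k * c * k * c]) ! i"

definition subsemigroup :: "'a::semigroup_mult set \<Rightarrow> bool" where
  "subsemigroup S \<longleftrightarrow> S \<noteq> {} \<and> (\<forall>x\<in>S. \<forall>y\<in>S. x * y \<in> S)"

inductive_set sg_span :: "'a::semigroup_mult set \<Rightarrow> 'a set" for A where
  base: "a \<in> A \<Longrightarrow> a \<in> sg_span A"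
| mult: "x \<in> sg_span A \<Longrightarrow> y \<in> sg_span A \<Longrightarrow> x * y \<in> sg_span A"

text \<open>The identity of a submonoid or subgroup in this sense need not be the ambient \<open>1\<close>.\<close>

definition is_monoid :: "'a::semigroup_mult set \<Rightarrow> bool" where
  "is_monoid S \<longleftrightarrow> (\<exists>e. monoid \<lparr>carrier = S, mult = (*), one = e\<rparr>)"

definition is_group :: "'a::semigroup_mult set \<Rightarrow> bool" where
  "is_group S \<longleftrightarrow> (\<exists>e. group \<lparr>carrier = S, mult = (*), one = e\<rparr>)"

definition sg_isomorphic :: "'a::semigroup_mult set \<Rightarrow> 'b::semigroup_mult set \<Rightarrow> bool" where
  "sg_isomorphic S T \<longleftrightarrow>
    (\<exists>f. bij_betw f S T \<and> (\<forall>x\<in>S. \<forall>y\<in>S. f (x * y) = f x * f y))"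

definition subsemigroups :: "kuratowski set set" where
  "subsemigroups = {S. subsemigroup S}"

definition lower_subsemigroups :: "kuratowski set set" where
  "lower_subsemigroups = {S \<in> subsemigroups. S \<subseteq> sg_span {\<sigma> 3, \<sigma> 4}}"

definition lower_monoids :: "kuratowski set set" where
  "lower_monoids = insert (\<sigma> 0) ` lower_subsemigroups"

text \<open>
  An isomorphism type is represented by the class of all subsemigroups of the monoid of
  Kuratowski operations that are isomorphic to a given one.
\<close>

definition iso_type :: "kuratowski set \<Rightarrow> kuratowski set set" where
  "iso_type S = {T \<in> subsemigroups. sg_isomorphic S T}"

end

theory Submission
  imports Defs "HOL-Library.Code_Binary_Nat" "HOL-Library.Nat_Bijection"
begin

text \<open>
  The defining relations hold for the left regular action of the generators on the indices
  \<open>0..13\<close>, which shows that the fourteen \<open>\<sigma> i\<close> are distinct; they exhaust the monoid because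
  they contain the identity and are closed under left multiplication by the generators.  Hence
  everything reduces to a finite multiplication table.  A pruned search finds all nonempty closed subsets; isomorphisms
  are certified by equal Cayley tables for suitable orderings of the elements; and nonisomorphic
  subsemigroups \<open>S\<close> are told apart by the number of pairs in \<open>S \<times> S\<close> with \<open>x * y = y * x\<close> and
  the number of pairs with \<open>x * y * x = x * y\<close>.
\<close>

section \<open>Rewriting with the defining relations\<close>

lemma compl_compl_op: "compl_op * compl_op = 1"
  by transfer (use kur_cong.compl_compl in simp)

lemma clos_clos_op: "clos_op * clos_op = clos_op"
  by transfer (use kur_cong.clos_clos in simp)

lemma clos_sigma12_op:
  "clos_op * (compl_op * (clos_op * (compl_op * (clos_op * (compl_op * clos_op)))))
    = clos_op * (compl_op * clos_op)"
  by transfer (use kur_cong.clos_sigma12 in simp)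

text \<open>Once products are associated to the right, a reducible subword is followed by further
  factors, so each rule also needs a form with a trailing \<open>x\<close>. At
  \<open>x = compl_op\<close>, \<open>clos_sigma12_op_left\<close> is the relation for
  \<open>\<sigma> 13\<close>.\<close>

lemma compl_compl_op_left: "compl_op * (compl_op * x) = x"
  by (metis compl_compl_op mult.assoc mult_1)

lemma clos_clos_op_left: "clos_op * (clos_op * x) = clos_op * x"
  by (metis clos_clos_op mult.assoc)

lemma clos_sigma12_op_left:
  "clos_op * (compl_op * (clos_op * (compl_op * (clos_op * (compl_op * (clos_op * x))))))
    = clos_op * (compl_op * (clos_op * x))"
  using clos_sigma12_op by (metis mult.assoc)

lemmas rewrite_op =
  compl_compl_op clos_clos_op clos_sigma12_op
  compl_compl_op_left clos_clos_op_left clos_sigma12_op_left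

section \<open>The left regular representation and the fourteen elements\<close>

lemma less_14_cases:
  "i < 14 \<longleftrightarrow> i \<in> {0, 1, 2, 3, 4, 5, 6, 7, 8, 9, 10, 11, 12, 13 :: nat}"
  unfolding insert_iff empty_iff by presburger

text \<open>\<open>act g i\<close> is the index of the product of \<open>g\<close> and \<open>\<sigma> i\<close>, i.e. the left regular representation.\<close>

fun act :: "generator \<Rightarrow> nat \<Rightarrow> nat" where
  "act Compl i = [1, 0, 4, 5, 2, 3, 8, 9, 6, 7, 12, 13, 10, 11] ! i"
| "act Clos i = [2, 3, 2, 3, 6, 7, 6, 7, 10, 11, 10, 11, 6, 7] ! i"

fun gen_op :: "generator \<Rightarrow> kuratowski" where
  "gen_op Compl = compl_op"
| "gen_op Clos = clos_op"

lemma act_less: "i < 14 \<Longrightarrow> act g i < 14"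
  unfolding less_14_cases by (cases g) auto

lemma foldr_act_less: "i < 14 \<Longrightarrow> foldr act w i < 14"
  by (induction w) (auto intro: act_less)

lemma sigma_act: "i < 14 \<Longrightarrow> \<sigma> (act g i) = gen_op g * \<sigma> i"
  unfolding less_14_cases
  by (cases g) (auto simp: \<sigma>_def Let_def mult.assoc rewrite_op)

text \<open>The defining relations are checked at each of the fourteen indices. The
  \<open>append\<close> case is separate because \<open>v\<close> moves the index first, and the
  hypothesis for \<open>u\<close> needs the new index to stay below 14.\<close>

lemma kur_cong_act: "kur_cong u v \<Longrightarrow> i < 14 \<Longrightarrow> foldr act u i = foldr act v i"
proof (induction arbitrary: i rule: kur_cong.induct)
  case (append u u' v v')
  then show ?case by (simp add: foldr_act_less)
qed (unfold less_14_cases, auto)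

text \<open>In the left regular representation a word sends the identity to the element it denotes,
  so the image of index 0 determines the element.\<close>

lift_definition index :: "kuratowski \<Rightarrow> nat" is "\<lambda>w. foldr act w 0"
  by (rule kur_cong_act) auto

lemma index_one: "index 1 = 0"
  by transfer simp

lemma index_compl: "index (compl_op * x) = act Compl (index x)"
  by transfer simp

lemma index_clos: "index (clos_op * x) = act Clos (index x)"
  by transfer simp

lemma index_generators: "index compl_op = 1" "index clos_op = 2"
  by (transfer; simp)+

text \<open>A left inverse of \<open>\<sigma>\<close> on the indices below 14, hence the fourteen
  elements are distinct.\<close>

lemma index_sigma: "i < 14 \<Longrightarrow> index (\<sigma> i) = i"
  unfolding less_14_cases
  by (auto simp: \<sigma>_def Let_def mult.assoc index_compl index_clos index_generators index_one)

lemma index_less: "index x < 14"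
  by transfer (simp add: foldr_act_less)

lemma sigma_foldr_act:
  "i < 14 \<Longrightarrow> \<sigma> (foldr act w i) = foldr (\<lambda>g x. gen_op g * x) w (\<sigma> i)"
  by (induction w) (simp_all add: sigma_act foldr_act_less)

lemma abs_kuratowski_eq_foldr: "abs_kuratowski w = foldr (\<lambda>g x. gen_op g * x) w 1"
proof (induction w)
  case Nil
  then show ?case by (simp add: one_kuratowski_def)
next
  case (Cons g w)
  have "abs_kuratowski (g # w) = abs_kuratowski [g] * abs_kuratowski w"
    by (simp add: times_kuratowski.abs_eq)
  also have "abs_kuratowski [g] = gen_op g"
    by (cases g) (simp_all add: compl_op_def clos_op_def)
  finally show ?case using Cons.IH by simp
qed

lemma sigma_0: "\<sigma> 0 = 1"
  by (simp add: \<sigma>_def Let_def)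

text \<open>A word is a chain of left multiplications applied to 1. Tracking that chain on indices
  from 0 shows that it never leaves the fourteen elements, so they exhaust the monoid.\<close>

lemma sigma_index: "\<sigma> (index x) = x"
proof -
  obtain w where x: "x = abs_kuratowski w"
    by (metis Quotient_abs_rep[OF Quotient_kuratowski])
  have "\<sigma> (index x) = foldr (\<lambda>g x. gen_op g * x) w (\<sigma> 0)"
    by (simp add: x index.abs_eq sigma_foldr_act)
  then show ?thesis by (simp add: x abs_kuratowski_eq_foldr sigma_0)
qed

lemma bij_betw_sigma: "bij_betw \<sigma> {..<14} UNIV"
  by (rule bij_betw_byWitness[where f' = index]) (auto simp: sigma_index index_sigma index_less)

section \<open>The multiplication table on indices\<close>

definition normal_form :: "nat \<Rightarrow> generator list" where
  "normal_form i = [[], [Compl], [Clos], [Clos, Compl], [Compl, Clos], [Compl, Clos, Compl],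
    [Clos, Compl, Clos], [Clos, Compl, Clos, Compl], [Compl, Clos, Compl, Clos],
    [Compl, Clos, Compl, Clos, Compl], [Clos, Compl, Clos, Compl, Clos],
    [Clos, Compl, Clos, Compl, Clos, Compl], [Compl, Clos, Compl, Clos, Compl, Clos],
    [Compl, Clos, Compl, Clos, Compl, Clos, Compl]] ! i"

text \<open>Left multiplication by \<open>\<sigma> i\<close> is the composite of the actions of its
  letters, so the table is derived from \<open>act\<close> instead of being listed.\<close>

definition kmul :: "nat \<Rightarrow> nat \<Rightarrow> nat" where
  "kmul i j = foldr act (normal_form i) j"

lemma kmul_less: "j < 14 \<Longrightarrow> kmul i j < 14"
  by (simp add: kmul_def foldr_act_less)

lemma sigma_kmul: "i < 14 \<Longrightarrow> j < 14 \<Longrightarrow> \<sigma> (kmul i j) = \<sigma> i * \<sigma> j"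
  unfolding kmul_def less_14_cases[of i]
  \<comment> \<open>\<open>act\<close> stays folded so that \<open>sigma_act\<close> can peel off
    one letter at a time.\<close>
  by (auto simp: normal_form_def sigma_act act_less \<sigma>_def[of 0] \<sigma>_def[of "Suc 0"]
      \<sigma>_def[of "numeral k" for k] Let_def mult.assoc simp del: act.simps)

text \<open>With naturals in binary, these ground equations let \<open>code_simp\<close> match a
  numeral instead of walking along a list.\<close>

lemma act_code [code]:
  "act Compl 0 = 1" "act Compl 1 = 0" "act Compl 2 = 4" "act Compl 3 = 5" "act Compl 4 = 2"
  "act Compl 5 = 3" "act Compl 6 = 8" "act Compl 7 = 9" "act Compl 8 = 6" "act Compl 9 = 7"
  "act Compl 10 = 12" "act Compl 11 = 13" "act Compl 12 = 10" "act Compl 13 = 11"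
  "act Clos 0 = 2" "act Clos 1 = 3" "act Clos 2 = 2" "act Clos 3 = 3" "act Clos 4 = 6"
  "act Clos 5 = 7" "act Clos 6 = 6" "act Clos 7 = 7" "act Clos 8 = 10" "act Clos 9 = 11"
  "act Clos 10 = 10" "act Clos 11 = 11" "act Clos 12 = 6" "act Clos 13 = 7"
  by simp_all

lemma normal_form_code [code]:
  "normal_form 0 = []" "normal_form 1 = [Compl]" "normal_form 2 = [Clos]"
  "normal_form 3 = [Clos, Compl]" "normal_form 4 = [Compl, Clos]"
  "normal_form 5 = [Compl, Clos, Compl]" "normal_form 6 = [Clos, Compl, Clos]"
  "normal_form 7 = [Clos, Compl, Clos, Compl]" "normal_form 8 = [Compl, Clos, Compl, Clos]"
  "normal_form 9 = [Compl, Clos, Compl, Clos, Compl]"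
  "normal_form 10 = [Clos, Compl, Clos, Compl, Clos]"
  "normal_form 11 = [Clos, Compl, Clos, Compl, Clos, Compl]"
  "normal_form 12 = [Compl, Clos, Compl, Clos, Compl, Clos]"
  "normal_form 13 = [Compl, Clos, Compl, Clos, Compl, Clos, Compl]"
  by (simp_all add: normal_form_def)

section \<open>Enumeration of the closed subsets\<close>

definition closed_list :: "nat list \<Rightarrow> bool" where
  "closed_list xs \<longleftrightarrow> (\<forall>x\<in>set xs. \<forall>y\<in>set xs. kmul x y \<in> set xs)"

definition subsemigroup_list :: "nat list \<Rightarrow> bool" where
  "subsemigroup_list xs \<longleftrightarrow> xs \<noteq> [] \<and> (\<forall>x\<in>set xs. x < 14) \<and> distinct xs \<and> closed_list xs"

definition ops :: "nat list \<Rightarrow> kuratowski set" where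
  "ops xs = \<sigma> ` set xs"

lemma inj_on_sigma: "inj_on \<sigma> {..<14}"
  using bij_betw_sigma by (rule bij_betw_imp_inj_on)

lemma sigma_image_subset_iff:
  assumes "A \<subseteq> {..<14}" "B \<subseteq> {..<14}"
  shows "\<sigma> ` A \<subseteq> \<sigma> ` B \<longleftrightarrow> A \<subseteq> B"
proof -
  have "\<sigma> i \<in> \<sigma> ` B \<longleftrightarrow> i \<in> B" if "i \<in> A" for i
    using that assms by (intro inj_on_image_mem_iff[OF inj_on_sigma]) auto
  then show ?thesis by (auto simp: image_subset_iff)
qed

lemma subsemigroup_ops: "subsemigroup_list xs \<Longrightarrow> subsemigroup (ops xs)"
  by (auto simp: subsemigroup_list_def subsemigroup_def ops_def closed_list_def
      simp flip: sigma_kmul)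

text \<open>
  A search tree that puts the elements one after another into \<open>ins\<close> or \<open>outs\<close>.  Pruning only
  looks at products of chosen elements, so a leaf need not be closed; every closed set is a leaf.
\<close>

fun closed_extensions :: "nat list \<Rightarrow> nat list \<Rightarrow> nat list \<Rightarrow> nat list list" where
  "closed_extensions [] ins outs = [ins]"
| "closed_extensions (x # xs) ins outs =
    (if \<forall>y\<in>set (x # ins). kmul x y \<notin> set outs \<and> kmul y x \<notin> set outs
     then closed_extensions xs (x # ins) outs else []) @
    (if \<forall>y\<in>set ins. \<forall>z\<in>set ins. kmul y z \<noteq> x
     then closed_extensions xs ins (x # outs) else [])"

text \<open>Take at each element the branch that agrees with membership in \<open>S\<close>. As
  \<open>ins\<close> lies in the closed set \<open>S\<close> and \<open>outs\<close> avoids it,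
  neither pruning test can cut this branch.\<close>

lemma closed_extensions_complete:
  assumes "\<forall>x\<in>S. \<forall>y\<in>S. kmul x y \<in> S"
    and "set ins \<subseteq> S" "S \<inter> set outs = {}" "S \<subseteq> set ins \<union> set xs"
  shows "\<exists>ys\<in>set (closed_extensions xs ins outs). set ys = S"
  using assms(2-)
proof (induction xs arbitrary: ins outs)
  case Nil
  then show ?case by auto
next
  case (Cons x xs)
  show ?case
  proof (cases "x \<in> S")
    case True
    then have "\<forall>y\<in>set (x # ins). kmul x y \<notin> set outs \<and> kmul y x \<notin> set outs"
      using assms(1) Cons.prems by auto
    moreover have "\<exists>ys\<in>set (closed_extensions xs (x # ins) outs). set ys = S"
      using True Cons.prems by (intro Cons.IH) auto
    ultimately show ?thesis by auto
  next
    case False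
    then have "\<forall>y\<in>set ins. \<forall>z\<in>set ins. kmul y z \<noteq> x"
      using assms(1) Cons.prems by blast
    moreover have "\<exists>ys\<in>set (closed_extensions xs ins (x # outs)). set ys = S"
      using False Cons.prems by (intro Cons.IH) auto
    ultimately show ?thesis by auto
  qed
qed

text \<open>
  One row for each isomorphism type.  The members of a row are listed in such an order that
  matching them position by position is an isomorphism.
\<close>

definition lower_types :: "nat list list list" where
  "lower_types =
    [[[2], [5], [7], [8], [10], [13]],
     [[10, 6], [7, 11], [8, 12], [13, 9]],
     [[2, 10], [5, 13]],
     [[7, 10], [8, 13]],
     [[7, 13], [8, 10]],
     [[2, 10, 6], [5, 13, 9]],
     [[2, 7, 10], [5, 8, 13]],
     [[2, 8, 10], [5, 7, 13]],
     [[3, 7, 11], [4, 8, 12]],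
     [[6, 7, 10, 11], [9, 8, 13, 12]],
     [[6, 8, 10, 12], [9, 7, 13, 11]],
     [[7, 8, 10, 13]],
     [[2, 6, 7, 10, 11], [5, 9, 8, 13, 12]],
     [[2, 6, 8, 10, 12], [5, 9, 7, 13, 11]],
     [[2, 7, 8, 10, 13], [5, 8, 7, 13, 10]],
     [[3, 6, 7, 10, 11], [4, 9, 8, 13, 12]],
     [[3, 7, 9, 11, 13], [4, 8, 6, 12, 10]],
     [[2, 3, 6, 7, 10, 11], [5, 4, 9, 8, 13, 12]],
     [[2, 4, 6, 8, 10, 12], [5, 3, 9, 7, 13, 11]],
     [[2, 5, 7, 8, 10, 13]],
     [[6, 7, 8, 9, 10, 11, 12, 13]],
     [[2, 6, 7, 8, 9, 10, 11, 12, 13], [5, 9, 8, 7, 6, 13, 12, 11, 10]],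
     [[3, 6, 7, 8, 9, 10, 11, 12, 13], [4, 9, 8, 7, 6, 13, 12, 11, 10]],
     [[2, 3, 6, 7, 8, 9, 10, 11, 12, 13], [5, 4, 9, 8, 7, 6, 13, 12, 11, 10]],
     [[2, 4, 6, 7, 8, 9, 10, 11, 12, 13], [5, 3, 9, 8, 7, 6, 13, 12, 11, 10]],
     [[2, 5, 6, 7, 8, 9, 10, 11, 12, 13]],
     [[2, 3, 5, 6, 7, 8, 9, 10, 11, 12, 13], [5, 4, 2, 9, 8, 7, 6, 13, 12, 11, 10]],
     [[2, 3, 4, 5, 6, 7, 8, 9, 10, 11, 12, 13]]]"

definition lower_lists :: "nat list list" where
  "lower_lists = concat lower_types"

definition subsemigroup_lists :: "nat list list" where
  "subsemigroup_lists = lower_lists @ map ((#) 0) lower_lists @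
    [[0], [0, 1], [0, 1, 6, 7, 8, 9, 10, 11, 12, 13], [0..<14]]"

lemma subsemigroup_lists_sound: "\<forall>xs\<in>set subsemigroup_lists. subsemigroup_list xs"
  by code_simp

text \<open>\<open>set_encode\<close> makes each finite set a number, so lists with the same members
  in different orders compare as equal. The entry \<open>[]\<close> accounts for the empty set,
  which the search also finds.\<close>

lemma subsemigroup_lists_complete:
  "set (map (set_encode \<circ> set) (closed_extensions (rev [0..<14]) [] []))
    \<subseteq> set (map (set_encode \<circ> set) ([] # subsemigroup_lists))"
  by code_simp

lemma distinct_set_encode: "distinct (map (set_encode \<circ> set) subsemigroup_lists)"
  by code_simp

lemma subsemigroups_eq: "subsemigroups = ops ` set subsemigroup_lists"
proof (intro equalityI subsetI)
  fix S assume "S \<in> subsemigroups"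
  then have S: "S \<noteq> {}" "\<forall>x\<in>S. \<forall>y\<in>S. x * y \<in> S"
    by (auto simp: subsemigroups_def subsemigroup_def)
  define I where "I = {i. i < 14 \<and> \<sigma> i \<in> S}"
  have S_eq: "S = \<sigma> ` I"
    using index_less sigma_index by (force simp: I_def image_iff)
  have "\<exists>ys\<in>set (closed_extensions (rev [0..<14]) [] []). set ys = I"
    using S(2) by (intro closed_extensions_complete) (auto simp: I_def kmul_less sigma_kmul)
  then obtain ys where ys: "ys \<in> set (closed_extensions (rev [0..<14]) [] [])" "set ys = I"
    by blast
  then have "(set_encode \<circ> set) ys \<in> (set_encode \<circ> set) ` set ([] # subsemigroup_lists)"
    using subsemigroup_lists_complete unfolding set_map by blast
  then obtain xs where xs: "xs \<in> set ([] # subsemigroup_lists)" "set ys = set xs"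
    unfolding image_iff comp_def set_encode_eq[OF finite_set finite_set] by blast
  \<comment> \<open>Nonemptiness of \<open>S\<close> excludes the extra entry
    \<open>[]\<close>.\<close>
  with ys(2) S(1) S_eq have "xs \<in> set subsemigroup_lists"
    by auto
  then show "S \<in> ops ` set subsemigroup_lists"
    using xs ys(2) S_eq by (auto simp: ops_def)
next
  fix S assume "S \<in> ops ` set subsemigroup_lists"
  then show "S \<in> subsemigroups"
    using subsemigroup_lists_sound subsemigroup_ops by (auto simp: subsemigroups_def)
qed

lemma subsemigroup_lists_less: "xs \<in> set subsemigroup_lists \<Longrightarrow> x \<in> set xs \<Longrightarrow> x < 14"
  using subsemigroup_lists_sound by (auto simp: subsemigroup_list_def)

lemma ops_subset_iff:
  assumes "xs \<in> set subsemigroup_lists" "ys \<in> set subsemigroup_lists"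
  shows "ops xs \<subseteq> ops ys \<longleftrightarrow> set xs \<subseteq> set ys"
  unfolding ops_def using assms subsemigroup_lists_less
  by (intro sigma_image_subset_iff) auto

lemma inj_on_ops: "inj_on ops (set subsemigroup_lists)"
proof (rule inj_onI)
  fix xs ys
  assume *: "xs \<in> set subsemigroup_lists" "ys \<in> set subsemigroup_lists" "ops xs = ops ys"
  then have "set xs = set ys"
    by (metis ops_subset_iff order_refl subset_antisym)
  then have "(set_encode \<circ> set) xs = (set_encode \<circ> set) ys" by simp
  with * show "xs = ys"
    using distinct_set_encode unfolding distinct_map by (blast dest: inj_onD)
qed

lemma distinct_subsemigroup_lists: "distinct subsemigroup_lists"
  using distinct_set_encode by (simp add: distinct_map)

lemma set_lower_lists: "set lower_lists = {xs \<in> set subsemigroup_lists. set xs \<subseteq> {2..13}}"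
proof -
  \<comment> \<open>Every entry after the initial segment \<open>lower_lists\<close> contains 0, so
    the filter returns exactly that segment.\<close>
  have "lower_lists = filter (\<lambda>xs. \<forall>x\<in>set xs. 2 \<le> x \<and> x \<le> 13) subsemigroup_lists"
    by code_simp
  then have "set lower_lists = set (filter (\<lambda>xs. \<forall>x\<in>set xs. 2 \<le> x \<and> x \<le> 13) subsemigroup_lists)"
    by (rule arg_cong)
  then show ?thesis by auto
qed

section \<open>Generated subsemigroups\<close>

definition span_list :: "nat list \<Rightarrow> nat list \<Rightarrow> bool" where
  "span_list gs xs \<longleftrightarrow> xs \<in> set subsemigroup_lists \<and> set gs \<subseteq> set xs \<and>
    (\<forall>ys\<in>set subsemigroup_lists. set gs \<subseteq> set ys \<longrightarrow> set xs \<subseteq> set ys)"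

lemma sg_span_subset: "subsemigroup S \<Longrightarrow> A \<subseteq> S \<Longrightarrow> sg_span A \<subseteq> S"
proof
  fix x assume "subsemigroup S" "A \<subseteq> S" "x \<in> sg_span A"
  from this(3,1,2) show "x \<in> S"
    by induction (auto simp: subsemigroup_def)
qed

lemma subsemigroup_sg_span: "A \<noteq> {} \<Longrightarrow> subsemigroup (sg_span A)"
  by (auto simp: subsemigroup_def intro: sg_span.intros)

text \<open>The span is itself in the enumeration, so leastness of \<open>xs\<close> among the
  listed sets containing \<open>gs\<close> gives one inclusion; closedness of \<open>ops xs\<close>
  gives the other. No products of generators have to be iterated.\<close>

lemma sg_span_eq_ops:
  assumes "span_list gs xs" "gs \<noteq> []"
  shows "sg_span (ops gs) = ops xs"
proof
  have xs: "xs \<in> set subsemigroup_lists" "set gs \<subseteq> set xs"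
    using assms by (auto simp: span_list_def)
  then have "ops xs \<in> subsemigroups"
    unfolding subsemigroups_eq by (rule_tac imageI)
  then show "sg_span (ops gs) \<subseteq> ops xs"
    using xs by (intro sg_span_subset) (auto simp: subsemigroups_def ops_def)
  have "sg_span (ops gs) \<in> subsemigroups"
    using assms(2) by (simp add: subsemigroups_def subsemigroup_sg_span ops_def)
  then obtain ys where ys: "ys \<in> set subsemigroup_lists" "sg_span (ops gs) = ops ys"
    unfolding subsemigroups_eq by blast
  have "\<sigma> ` set gs \<subseteq> \<sigma> ` set ys"
    using ys(2) by (auto simp: ops_def intro: sg_span.base)
  then have "set gs \<subseteq> set ys"
    using xs ys subsemigroup_lists_less by (subst (asm) sigma_image_subset_iff) blast+
  then have "set xs \<subseteq> set ys"
    using assms(1) ys(1) by (simp add: span_list_def)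
  then show "ops xs \<subseteq> sg_span (ops gs)"
    using ys(2) by (auto simp: ops_def)
qed

lemma sg_span_sigma:
  "sg_span {\<sigma> 3, \<sigma> 4} = ops [2..<14]"
  "sg_span {\<sigma> 0} = ops [0]"
  "sg_span {\<sigma> 1} = ops [0, 1]"
  "sg_span {\<sigma> 1, \<sigma> 6} = ops [0, 1, 6, 7, 8, 9, 10, 11, 12, 13]"
  "sg_span {\<sigma> 1, \<sigma> 2} = ops [0..<14]"
proof -
  have "span_list [3, 4] [2, 3, 4, 5, 6, 7, 8, 9, 10, 11, 12, 13]" by code_simp
  from sg_span_eq_ops[OF this] show "sg_span {\<sigma> 3, \<sigma> 4} = ops [2..<14]"
    by (simp add: ops_def upt_rec)
  have "span_list [0] [0]" by code_simp
  from sg_span_eq_ops[OF this] show "sg_span {\<sigma> 0} = ops [0]"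
    by (simp add: ops_def)
  have "span_list [1] [0, 1]" by code_simp
  from sg_span_eq_ops[OF this] show "sg_span {\<sigma> 1} = ops [0, 1]"
    by (simp add: ops_def)
  have "span_list [1, 6] [0, 1, 6, 7, 8, 9, 10, 11, 12, 13]" by code_simp
  from sg_span_eq_ops[OF this]
  show "sg_span {\<sigma> 1, \<sigma> 6} = ops [0, 1, 6, 7, 8, 9, 10, 11, 12, 13]"
    by (simp add: ops_def)
  have "span_list [1, 2] [0..<14]" by code_simp
  from sg_span_eq_ops[OF this] show "sg_span {\<sigma> 1, \<sigma> 2} = ops [0..<14]"
    by (simp add: ops_def)
qed

lemma sg_span_1_2: "sg_span {\<sigma> 1, \<sigma> 2} = UNIV"
  unfolding sg_span_sigma ops_def set_upt atLeast0LessThan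
  using bij_betw_sigma by (rule bij_betw_imp_surj_on)

lemma sg_span_3_4: "sg_span {\<sigma> 3, \<sigma> 4} = \<sigma> ` {2..13}"
proof -
  have "set [2..<14] = {2..13 :: nat}" by (simp only: set_upt) auto
  then show ?thesis by (simp only: sg_span_sigma ops_def)
qed

section \<open>Partition and number of the subsemigroups\<close>

lemma lower_subsemigroups_eq: "lower_subsemigroups = ops ` set lower_lists"
proof -
  have "ops xs \<subseteq> \<sigma> ` {2..13} \<longleftrightarrow> set xs \<subseteq> {2..13}" if "xs \<in> set subsemigroup_lists" for xs
    unfolding ops_def using that
    by (intro sigma_image_subset_iff) (auto dest: subsemigroup_lists_less)
  then show ?thesis
    by (auto simp: lower_subsemigroups_def subsemigroups_eq sg_span_3_4 set_lower_lists)
qed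

lemma lower_monoids_eq: "lower_monoids = ops ` set (map ((#) 0) lower_lists)"
  by (simp add: lower_monoids_def lower_subsemigroups_eq image_image ops_def)

lemma card_subsemigroups: "card subsemigroups = 118"
proof -
  have "length subsemigroup_lists = 118" by code_simp
  then show ?thesis
    by (simp add: subsemigroups_eq card_image[OF inj_on_ops]
        distinct_card[OF distinct_subsemigroup_lists])
qed

lemma length_lower_lists: "length lower_lists = 57"
  by code_simp

lemma card_lower_subsemigroups: "card lower_subsemigroups = 57"
  unfolding lower_subsemigroups_eq
  using distinct_subsemigroup_lists length_lower_lists
  by (subst card_image[OF inj_on_subset[OF inj_on_ops]])
    (auto simp: subsemigroup_lists_def distinct_card)

lemma card_lower_monoids: "card lower_monoids = 57"
  unfolding lower_monoids_eq
  using distinct_subsemigroup_lists length_lower_lists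
  by (subst card_image[OF inj_on_subset[OF inj_on_ops]])
    (auto simp: subsemigroup_lists_def distinct_card simp del: set_map)

lemma subsemigroups_partition:
  "subsemigroups = lower_subsemigroups \<union> lower_monoids
    \<union> {sg_span {\<sigma> 0}, sg_span {\<sigma> 1}, sg_span {\<sigma> 1, \<sigma> 6}, sg_span {\<sigma> 1, \<sigma> 2}}"
  unfolding subsemigroups_eq lower_subsemigroups_eq lower_monoids_eq sg_span_sigma
    subsemigroup_lists_def by (simp del: upt_rec_numeral) blast

section \<open>Monoids and groups among them\<close>

lemma is_monoid_if_one:
  fixes S :: "'a::monoid_mult set"
  assumes "subsemigroup S" "1 \<in> S"
  shows "is_monoid S"
  unfolding is_monoid_def using assms
  by (intro exI[of _ 1] monoidI) (auto simp: subsemigroup_def mult.assoc)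

lemma is_group_if_involutive:
  fixes S :: "'a::monoid_mult set"
  assumes "subsemigroup S" "\<forall>x\<in>S. x * x = 1"
  shows "is_group S"
proof -
  \<comment> \<open>Any element of the nonempty set \<open>S\<close> has its square, which is 1, in
    \<open>S\<close>.\<close>
  have "1 \<in> S" using assms unfolding subsemigroup_def by (metis ex_in_conv)
  then have "group \<lparr>carrier = S, mult = (*), one = 1\<rparr>"
    using assms by (intro groupI) (auto simp: subsemigroup_def mult.assoc)
  then show ?thesis unfolding is_group_def ..
qed

lemma subsemigroup_ops_if_mem: "xs \<in> set subsemigroup_lists \<Longrightarrow> subsemigroup (ops xs)"
  using subsemigroup_lists_sound subsemigroup_ops by blast

lemma is_monoid_ops:
  assumes "xs \<in> set subsemigroup_lists" "0 \<in> set xs"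
  shows "is_monoid (ops xs)"
proof (rule is_monoid_if_one)
  have "\<sigma> 0 \<in> ops xs" using assms(2) by (auto simp: ops_def)
  then show "1 \<in> ops xs" by (simp add: sigma_0)
qed (rule subsemigroup_ops_if_mem[OF assms(1)])

section \<open>Isomorphism as an equivalence relation\<close>

lemma sg_isomorphic_refl: "sg_isomorphic S S"
  unfolding sg_isomorphic_def by (rule exI[of _ id]) auto

lemma sg_isomorphic_sym:
  assumes "subsemigroup S" "sg_isomorphic S T"
  shows "sg_isomorphic T S"
proof -
  obtain f where f: "bij_betw f S T" "\<forall>x\<in>S. \<forall>y\<in>S. f (x * y) = f x * f y"
    using assms(2) by (auto simp: sg_isomorphic_def)
  let ?g = "inv_into S f"
  have g: "bij_betw ?g T S" using f(1) by (rule bij_betw_inv_into)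
  have "?g (u * v) = ?g u * ?g v" if "u \<in> T" "v \<in> T" for u v
  proof -
    have *: "?g u \<in> S" "?g v \<in> S" using g that by (auto dest: bij_betwE)
    then have "f (?g u * ?g v) = u * v"
      using f that by (simp add: bij_betw_inv_into_right)
    \<comment> \<open>\<open>inv_into S f\<close> undoes \<open>f\<close> only on \<open>S\<close>,
      so the product must be known to lie there.\<close>
    moreover have "?g u * ?g v \<in> S" using * assms(1) by (simp add: subsemigroup_def)
    ultimately show ?thesis by (metis f(1) bij_betw_inv_into_left)
  qed
  with g show ?thesis unfolding sg_isomorphic_def by blast
qed

lemma sg_isomorphic_trans:
  assumes "sg_isomorphic S T" "sg_isomorphic T U"
  shows "sg_isomorphic S U"
proof -
  obtain f g where f: "bij_betw f S T" "\<forall>x\<in>S. \<forall>y\<in>S. f (x * y) = f x * f y"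
    and g: "bij_betw g T U" "\<forall>x\<in>T. \<forall>y\<in>T. g (x * y) = g x * g y"
    using assms by (auto simp: sg_isomorphic_def)
  have "bij_betw (g \<circ> f) S U" using f(1) g(1) by (rule bij_betw_trans)
  moreover have "\<forall>x\<in>S. \<forall>y\<in>S. (g \<circ> f) (x * y) = (g \<circ> f) x * (g \<circ> f) y"
    using f g by (simp add: bij_betwE)
  ultimately show ?thesis unfolding sg_isomorphic_def by blast
qed

lemma iso_type_eq_iff:
  assumes "S \<in> subsemigroups" "T \<in> subsemigroups"
  shows "iso_type S = iso_type T \<longleftrightarrow> sg_isomorphic S T"
proof
  assume "iso_type S = iso_type T"
  then show "sg_isomorphic S T"
    using assms(2) sg_isomorphic_refl by (auto simp: iso_type_def)
next
  assume "sg_isomorphic S T"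
  moreover then have "sg_isomorphic T S"
    using assms(1) by (auto simp: subsemigroups_def intro: sg_isomorphic_sym)
  ultimately show "iso_type S = iso_type T"
    by (auto simp: iso_type_def intro: sg_isomorphic_trans)
qed

section \<open>Isomorphisms from Cayley tables\<close>

fun position :: "nat list \<Rightarrow> nat \<Rightarrow> nat" where
  "position [] x = 0"
| "position (y # ys) x = (if x = y then 0 else Suc (position ys x))"

text \<open>For an element outside the list \<open>position\<close> runs to the end and returns
  \<open>length xs\<close>, so membership is exactly what makes it a valid index.\<close>

lemma position_less: "x \<in> set xs \<Longrightarrow> position xs x < length xs"
  by (induction xs) auto

lemma nth_position: "x \<in> set xs \<Longrightarrow> xs ! position xs x = x"
  by (induction xs) auto

lemma position_nth: "distinct xs \<Longrightarrow> i < length xs \<Longrightarrow> position xs (xs ! i) = i"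
  by (metis nth_eq_iff_index_eq nth_mem nth_position position_less)

text \<open>Products are recorded by position, which removes the names of the elements: tables of
  different sets can be literally equal.\<close>

definition cayley_table :: "nat list \<Rightarrow> nat list list" where
  "cayley_table xs = map (\<lambda>x. map (\<lambda>y. position xs (kmul x y)) xs) xs"

lemma sg_isomorphic_ops:
  assumes "subsemigroup_list xs" "subsemigroup_list ys" "cayley_table xs = cayley_table ys"
  shows "sg_isomorphic (ops xs) (ops ys)"
proof -
  have len: "length xs = length ys"
    using arg_cong[OF assms(3), of length] by (simp add: cayley_table_def)
  have dist: "distinct xs" "distinct ys" and less: "\<And>x. x \<in> set xs \<Longrightarrow> x < 14"
    "\<And>y. y \<in> set ys \<Longrightarrow> y < 14"
    using assms(1,2) by (auto simp: subsemigroup_list_def)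
  \<comment> \<open>The matching position by position; distinctness and equal lengths make it a
    bijection, and equal tables make it multiplicative.\<close>
  define g where "g x = ys ! position xs x" for x
  have g_mem: "g x \<in> set ys" if "x \<in> set xs" for x
    using that position_less len by (metis g_def nth_mem)
  have g_mult: "g (kmul x y) = kmul (g x) (g y)" if "x \<in> set xs" "y \<in> set xs" for x y
  proof -
    define i j where "i = position xs x" and "j = position xs y"
    have ij: "i < length ys" "j < length ys" "x = xs ! i" "y = xs ! j"
      using that by (simp_all add: i_def j_def position_less nth_position flip: len)
    have "cayley_table xs ! i ! j = cayley_table ys ! i ! j"
      by (simp add: assms(3))
    then have "position xs (kmul x y) = position ys (kmul (ys ! i) (ys ! j))"
      using ij by (simp add: cayley_table_def len)
    \<comment> \<open>Closedness makes the position of this product in \<open>ys\<close> a genuine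
      one, so \<open>nth_position\<close> recovers the product.\<close>
    moreover have "kmul (ys ! i) (ys ! j) \<in> set ys"
      using assms(2) ij by (simp add: subsemigroup_list_def closed_list_def)
    ultimately show ?thesis
      by (simp add: g_def nth_position flip: i_def j_def)
  qed
  have "inj_on g (set xs)"
    using dist len by (intro inj_onI) (metis g_def nth_eq_iff_index_eq nth_position position_less)
  moreover have "g ` set xs = set ys"
  proof (intro equalityI subsetI)
    fix y assume "y \<in> set ys"
    then have "position ys y < length xs" "y = g (xs ! position ys y)"
      using dist len by (simp_all add: g_def position_less position_nth nth_position)
    then show "y \<in> g ` set xs" by auto
  qed (use g_mem in auto)
  ultimately have g: "bij_betw g (set xs) (set ys)" by (simp add: bij_betw_def)
  have sig: "bij_betw \<sigma> (set ys) (ops ys)" "bij_betw index (ops xs) (set xs)"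
    unfolding ops_def
    by (rule bij_betw_byWitness[where f' = index], use less index_sigma sigma_index in auto)
      (rule bij_betw_byWitness[where f' = \<sigma>], use less index_sigma sigma_index in auto)
  have "bij_betw (\<sigma> \<circ> (g \<circ> index)) (ops xs) (ops ys)"
    using bij_betw_trans[OF bij_betw_trans[OF sig(2) g] sig(1)] .
  moreover have "(\<sigma> \<circ> (g \<circ> index)) (a * b) = (\<sigma> \<circ> (g \<circ> index)) a * (\<sigma> \<circ> (g \<circ> index)) b"
    if ab: "a \<in> ops xs" "b \<in> ops xs" for a b
  proof -
    obtain x y where xy: "x \<in> set xs" "y \<in> set xs" "a = \<sigma> x" "b = \<sigma> y"
      using ab by (auto simp: ops_def)
    then have "index (a * b) = kmul x y"
      by (metis index_sigma kmul_less less(1) sigma_kmul)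
    then show ?thesis
      using xy by (simp add: g_mult index_sigma less sigma_kmul g_mem)
  qed
  ultimately show ?thesis unfolding sg_isomorphic_def by blast
qed

lemma iso_type_ops_eq:
  assumes "xs \<in> set subsemigroup_lists" "ys \<in> set subsemigroup_lists"
    and "cayley_table xs = cayley_table ys"
  shows "iso_type (ops xs) = iso_type (ops ys)"
  using assms subsemigroup_lists_sound
  by (subst iso_type_eq_iff) (auto simp: subsemigroups_eq intro: sg_isomorphic_ops)

section \<open>Invariants separating the types\<close>

definition pair_counts :: "'a::semigroup_mult set \<Rightarrow> nat \<times> nat" where
  "pair_counts S =
    (card {(x, y) \<in> S \<times> S. x * y = y * x}, card {(x, y) \<in> S \<times> S. x * y * x = x * y})"

text \<open>Both counts concern solutions of equations between products, so
  \<open>map_prod f f\<close> carries one solution set bijectively onto the other.\<close>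

lemma pair_counts_eq:
  assumes "subsemigroup S" "sg_isomorphic S T"
  shows "pair_counts S = pair_counts T"
proof -
  obtain f where f: "bij_betw f S T" "\<And>x y. x \<in> S \<Longrightarrow> y \<in> S \<Longrightarrow> f (x * y) = f x * f y"
    using assms(2) by (auto simp: sg_isomorphic_def)
  have closed: "x * y \<in> S" if "x \<in> S" "y \<in> S" for x y
    using assms(1) that by (simp add: subsemigroup_def)
  have eq_iff: "f x = f y \<longleftrightarrow> x = y" if "x \<in> S" "y \<in> S" for x y
    using f(1) that by (auto simp: bij_betw_def dest: inj_onD)
  have ff: "bij_betw (map_prod f f) (S \<times> S) (T \<times> T)"
    using f(1) f(1) by (rule bij_betw_map_prod)
  have card_eq: "card {(x, y) \<in> S \<times> S. P x y} = card {(x, y) \<in> T \<times> T. Q x y}"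
    if "\<And>x y. x \<in> S \<Longrightarrow> y \<in> S \<Longrightarrow> P x y \<longleftrightarrow> Q (f x) (f y)" for P Q
  proof -
    have "map_prod f f ` {(x, y) \<in> S \<times> S. P x y} = {(x, y) \<in> T \<times> T. Q x y}"
      using f(1) that by (fastforce simp: bij_betw_def)
    then have "bij_betw (map_prod f f) {(x, y) \<in> S \<times> S. P x y} {(x, y) \<in> T \<times> T. Q x y}"
      by (intro bij_betw_subset[OF ff]) auto
    then show ?thesis by (rule bij_betw_same_card)
  qed
  show ?thesis
    unfolding pair_counts_def
    by (intro arg_cong2[where f = Pair] card_eq) (simp_all add: closed eq_iff flip: f(2))
qed

definition pair_counts_list :: "nat list \<Rightarrow> nat \<times> nat" where
  "pair_counts_list xs =
    (length (filter (\<lambda>(x, y). kmul x y = kmul y x) (List.product xs xs)),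
     length (filter (\<lambda>(x, y). kmul (kmul x y) x = kmul x y) (List.product xs xs)))"

lemma pair_counts_ops:
  assumes "subsemigroup_list xs"
  shows "pair_counts (ops xs) = pair_counts_list xs"
proof -
  have less: "x < 14" if "x \<in> set xs" for x
    using assms that by (simp add: subsemigroup_list_def)
  have inj: "inj_on \<sigma> (set xs)"
    by (rule inj_on_subset[OF inj_on_sigma]) (auto dest: less)
  have sigma_eq_iff: "\<sigma> x = \<sigma> y \<longleftrightarrow> x = y" if "x < 14" "y < 14" for x y
    using that by (metis index_sigma)
  have *: "card {(a, b) \<in> ops xs \<times> ops xs. P a b} = length (filter (\<lambda>(x, y). Q x y) (List.product xs xs))"
    if PQ: "\<And>x y. x < 14 \<Longrightarrow> y < 14 \<Longrightarrow> P (\<sigma> x) (\<sigma> y) \<longleftrightarrow> Q x y" for P Q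
  proof -
    have "{(a, b) \<in> ops xs \<times> ops xs. P a b} =
        map_prod \<sigma> \<sigma> ` set (filter (\<lambda>(x, y). Q x y) (List.product xs xs))"
      using PQ less by (force simp: ops_def)
    also have "card \<dots> = card (set (filter (\<lambda>(x, y). Q x y) (List.product xs xs)))"
      using inj by (intro card_image inj_on_subset[OF map_prod_inj_on[OF inj inj]]) auto
    also have "\<dots> = length (filter (\<lambda>(x, y). Q x y) (List.product xs xs))"
      using assms by (intro distinct_card distinct_filter distinct_product)
        (auto simp: subsemigroup_list_def)
    finally show ?thesis .
  qed
  show ?thesis
    unfolding pair_counts_def pair_counts_list_def
    by (intro arg_cong2[where f = Pair] *) (simp_all add: sigma_eq_iff kmul_less flip: sigma_kmul)
qed

section \<open>Representatives and the number of isomorphism types\<close>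

definition lower_representatives :: "nat list list" where
  "lower_representatives = map hd lower_types"

text \<open>
  The first two representatives, \<open>{\<sigma> 2}\<close> and \<open>{\<sigma> 6, \<sigma> 10}\<close>, are dropped: adjoining \<open>\<sigma> 0\<close>
  to them gives the types of \<open>{\<sigma> 2, \<sigma> 10}\<close> and \<open>{\<sigma> 2, \<sigma> 6, \<sigma> 10}\<close>.
\<close>

definition upper_representatives :: "nat list list" where
  "upper_representatives = map ((#) 0) (drop 2 lower_representatives)"

definition representatives :: "nat list list" where
  "representatives = lower_representatives @ upper_representatives @
    [[0, 1, 6, 7, 8, 9, 10, 11, 12, 13], [0..<14]]"

lemma representatives_subset: "set representatives \<subseteq> set subsemigroup_lists"
  by code_simp

text \<open>The number of commuting pairs cannot tell a semigroup from its opposite. The second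
  count can: it is 4 on the left zero semigroup with indices 7, 13 and 2 on the right zero semigroup
  with indices 7, 10.\<close>

lemma distinct_pair_counts: "distinct (map pair_counts_list representatives)"
  by code_simp

text \<open>Prepending 0 extends each matching by fixing the identity, so the same rows also certify
  isomorphisms between the monoids with \<open>\<sigma> 0\<close> adjoined.\<close>

lemma cayley_table_lower_types:
  "\<forall>xss\<in>set lower_types. \<forall>xs\<in>set xss.
    cayley_table xs = cayley_table (hd xss) \<and> cayley_table (0 # xs) = cayley_table (0 # hd xss)"
  by code_simp

lemma inj_on_iso_type: "inj_on (iso_type \<circ> ops) (set representatives)"
proof (rule inj_onI)
  fix xs ys
  assume *: "xs \<in> set representatives" "ys \<in> set representatives"
    "(iso_type \<circ> ops) xs = (iso_type \<circ> ops) ys"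
  then have lists: "xs \<in> set subsemigroup_lists" "ys \<in> set subsemigroup_lists"
    using representatives_subset by auto
  then have "sg_isomorphic (ops xs) (ops ys)"
    using *(3) by (subst iso_type_eq_iff[symmetric]) (auto simp: subsemigroups_eq)
  then have "pair_counts (ops xs) = pair_counts (ops ys)"
    using lists(1) by (intro pair_counts_eq subsemigroup_ops_if_mem)
  then have "pair_counts_list xs = pair_counts_list ys"
    using lists subsemigroup_lists_sound by (simp add: pair_counts_ops)
  with * show "xs = ys"
    using distinct_pair_counts unfolding distinct_map by (blast dest: inj_onD)
qed

lemma card_iso_type_image:
  assumes "set Rs \<subseteq> set representatives" "distinct Rs"
  shows "card ((iso_type \<circ> ops) ` set Rs) = length Rs"
  by (simp only: card_image[OF inj_on_subset[OF inj_on_iso_type assms(1)]]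
      distinct_card[OF assms(2)])

lemma mem_subsemigroup_lists:
  assumes "xss \<in> set lower_types" "xs \<in> set xss"
  shows "xs \<in> set subsemigroup_lists" "0 # xs \<in> set subsemigroup_lists"
  using assms by (auto simp: subsemigroup_lists_def lower_lists_def)

lemma hd_mem_lower_types: "\<forall>xss\<in>set lower_types. hd xss \<in> set xss"
  by code_simp

lemma iso_type_lower_types:
  assumes "xss \<in> set lower_types" "xs \<in> set xss"
  shows "iso_type (ops xs) = iso_type (ops (hd xss))"
    and "iso_type (ops (0 # xs)) = iso_type (ops (0 # hd xss))"
proof -
  have "hd xss \<in> set xss"
    using assms(1) hd_mem_lower_types by blast
  moreover have "cayley_table xs = cayley_table (hd xss)"
    "cayley_table (0 # xs) = cayley_table (0 # hd xss)"
    using assms cayley_table_lower_types by blast+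
  ultimately show "iso_type (ops xs) = iso_type (ops (hd xss))"
    and "iso_type (ops (0 # xs)) = iso_type (ops (0 # hd xss))"
    using assms by (metis iso_type_ops_eq mem_subsemigroup_lists)+
qed

text \<open>\<open>f\<close> is constant on each row, and each row is nonempty because it contains
  its head.\<close>

lemma image_concat_eq_image_hd:
  assumes "\<forall>xs\<in>set xss. hd xs \<in> set xs" "\<forall>xs\<in>set xss. \<forall>x\<in>set xs. f x = f (hd xs)"
  shows "f ` set (concat xss) = f ` set (map hd xss)"
proof -
  have "f ` set xs = {f (hd xs)}" if "xs \<in> set xss" for xs
    using that assms by blast
  then have "(\<Union>xs\<in>set xss. f ` set xs) = (\<Union>xs\<in>set xss. {f (hd xs)})" by (intro SUP_cong) auto
  then show ?thesis by (simp add: image_UN UNION_singleton_eq_range image_image)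
qed

lemma iso_type_lower_subsemigroups:
  "iso_type ` lower_subsemigroups = (iso_type \<circ> ops) ` set lower_representatives"
proof -
  have "(iso_type \<circ> ops) ` set (concat lower_types)
      = (iso_type \<circ> ops) ` set (map hd lower_types)"
    using hd_mem_lower_types iso_type_lower_types(1)
    by (intro image_concat_eq_image_hd) (auto simp only: comp_apply)
  then show ?thesis
    unfolding lower_subsemigroups_eq lower_lists_def lower_representatives_def image_comp .
qed

lemma iso_type_lower_monoids_eq_image:
  "iso_type ` lower_monoids = (iso_type \<circ> ops) ` set (map ((#) 0) lower_representatives)"
proof -
  have "(iso_type \<circ> ops \<circ> (#) 0) ` set (concat lower_types)
      = (iso_type \<circ> ops \<circ> (#) 0) ` set (map hd lower_types)"
    using hd_mem_lower_types iso_type_lower_types(2)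
    by (intro image_concat_eq_image_hd) (auto simp only: comp_apply)
  then show ?thesis
    unfolding lower_monoids_eq lower_lists_def lower_representatives_def set_map[of "(#) 0"]
      image_comp comp_assoc .
qed

text \<open>The coincidences: trivial semigroups; groups of order two, where
  \<open>\<sigma> 10\<close> is the identity and \<open>\<sigma> 6\<close> squares to it; and
  \<open>\<sigma> 2\<close> acting as an adjoined identity on \<open>\<sigma> 10\<close> and
  \<open>\<sigma> 6\<close>, just as \<open>\<sigma> 0\<close> does.\<close>

lemma iso_type_small:
  "iso_type (ops [0]) = iso_type (ops [2])"
  "iso_type (ops [0, 1]) = iso_type (ops [10, 6])"
  "iso_type (ops [0, 2]) = iso_type (ops [2, 10])"
  "iso_type (ops [0, 10, 6]) = iso_type (ops [2, 10, 6])"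
  by (rule iso_type_ops_eq; code_simp)+

lemma lower_representatives_eq:
  "lower_representatives = [2] # [10, 6] # drop 2 lower_representatives"
  by code_simp

lemma small_mem_lower_representatives:
  "{[2], [10, 6], [2, 10], [2, 10, 6]} \<subseteq> set lower_representatives"
  by code_simp

lemma iso_type_lower_monoids:
  "iso_type ` lower_monoids =
    {iso_type (ops [2, 10]), iso_type (ops [2, 10, 6])} \<union> (iso_type \<circ> ops) ` set upper_representatives"
proof -
  have "map ((#) 0) lower_representatives = [0, 2] # [0, 10, 6] # upper_representatives"
    by (subst lower_representatives_eq) (simp add: upper_representatives_def)
  then show ?thesis
    by (simp add: iso_type_lower_monoids_eq_image iso_type_small)
qed

text \<open>Distinct representatives have distinct types, so the types of
  \<open>upper_representatives\<close> avoid all lower types, while the two remaining monoid types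
  are lower ones.\<close>

lemma iso_type_new_monoids:
  "iso_type ` lower_monoids - iso_type ` lower_subsemigroups
    = (iso_type \<circ> ops) ` set upper_representatives"
proof -
  have "distinct representatives"
    using distinct_pair_counts by (simp add: distinct_map)
  then have "set lower_representatives \<inter> set upper_representatives = {}"
    by (auto simp: representatives_def)
  then have "(iso_type \<circ> ops) ` set lower_representatives
      \<inter> (iso_type \<circ> ops) ` set upper_representatives = {}"
    by (subst inj_on_image_Int[OF inj_on_iso_type, symmetric]) (auto simp: representatives_def)
  moreover have "{iso_type (ops [2, 10]), iso_type (ops [2, 10, 6])}
      \<subseteq> (iso_type \<circ> ops) ` set lower_representatives"
    using small_mem_lower_representatives by auto
  ultimately show ?thesis
    unfolding iso_type_lower_subsemigroups iso_type_lower_monoids by blast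
qed

lemma iso_type_subsemigroups:
  "iso_type ` subsemigroups = iso_type ` lower_subsemigroups \<union> iso_type ` lower_monoids
    \<union> {iso_type (sg_span {\<sigma> 1, \<sigma> 6}), iso_type (sg_span {\<sigma> 1, \<sigma> 2})}"
proof -
  \<comment> \<open>These are the types of the two groups, which therefore add nothing to the lower
    types.\<close>
  have "{iso_type (ops [2]), iso_type (ops [10, 6])} \<subseteq> iso_type ` lower_subsemigroups"
    unfolding iso_type_lower_subsemigroups using small_mem_lower_representatives by auto
  moreover have "iso_type (sg_span {\<sigma> 0}) = iso_type (ops [2])"
    "iso_type (sg_span {\<sigma> 1}) = iso_type (ops [10, 6])"
    by (simp_all only: sg_span_sigma iso_type_small)
  ultimately show ?thesis
    unfolding subsemigroups_partition by auto
qed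

lemma iso_type_subsemigroups_representatives:
  "iso_type ` subsemigroups = (iso_type \<circ> ops) ` set representatives"
proof -
  have "iso_type ` lower_subsemigroups \<union> iso_type ` lower_monoids
      = (iso_type \<circ> ops) ` set (lower_representatives @ upper_representatives)"
    using iso_type_new_monoids unfolding iso_type_lower_subsemigroups set_append image_Un by blast
  then show ?thesis
    unfolding iso_type_subsemigroups sg_span_sigma representatives_def by simp
qed

lemma card_iso_types:
  "card (iso_type ` subsemigroups) = 56"
  "card (iso_type ` lower_subsemigroups) = 28"
  "card (iso_type ` lower_monoids - iso_type ` lower_subsemigroups) = 26"
proof -
  have dist: "distinct representatives"
    using distinct_pair_counts by (simp add: distinct_map)
  have len: "length representatives = 56" "length lower_representatives = 28"
    "length upper_representatives = 26"
    by code_simp+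
  show "card (iso_type ` subsemigroups) = 56"
    using dist unfolding iso_type_subsemigroups_representatives
    by (subst card_iso_type_image) (simp_all add: len)
  show "card (iso_type ` lower_subsemigroups) = 28"
    using dist unfolding iso_type_lower_subsemigroups
    by (subst card_iso_type_image) (auto simp add: len representatives_def)
  show "card (iso_type ` lower_monoids - iso_type ` lower_subsemigroups) = 26"
    using dist unfolding iso_type_new_monoids
    by (subst card_iso_type_image) (auto simp add: len representatives_def)
qed

lemma is_monoid_lower_monoids: "\<forall>S\<in>lower_monoids. is_monoid S"
  unfolding lower_monoids_eq by (auto simp: subsemigroup_lists_def intro!: is_monoid_ops)

lemma is_group_span_0_1: "is_group (sg_span {\<sigma> 0})" "is_group (sg_span {\<sigma> 1})"
proof -
  have "\<sigma> 1 = compl_op" by (simp add: \<sigma>_def Let_def)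
  then have "\<forall>x\<in>ops [0]. x * x = 1" "\<forall>x\<in>ops [0, 1]. x * x = 1"
    by (simp_all add: ops_def sigma_0 compl_compl_op)
  moreover have "subsemigroup (ops [0])" "subsemigroup (ops [0, 1])"
    by (simp_all add: subsemigroup_ops_if_mem subsemigroup_lists_def)
  ultimately show "is_group (sg_span {\<sigma> 0})" "is_group (sg_span {\<sigma> 1})"
    unfolding sg_span_sigma by (blast intro: is_group_if_involutive)+
qed

lemma is_monoid_spans:
  "is_monoid (sg_span {\<sigma> 1, \<sigma> 6})" "is_monoid (sg_span {\<sigma> 1, \<sigma> 2})"
  unfolding sg_span_sigma by (rule is_monoid_ops; simp add: subsemigroup_lists_def)+

theorem mainTheorem1:
  shows "sg_span {\<sigma> 3, \<sigma> 4} = \<sigma> ` {2..13}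
    \<and> sg_span {\<sigma> 1, \<sigma> 2} = (UNIV :: kuratowski set)
    \<and> card subsemigroups = 118
    \<and> (118::nat) = 2 * 57 + 4
    \<and> subsemigroups = lower_subsemigroups \<union> lower_monoids
        \<union> {sg_span {\<sigma> 0}, sg_span {\<sigma> 1}, sg_span {\<sigma> 1, \<sigma> 6}, sg_span {\<sigma> 1, \<sigma> 2}}
    \<and> card lower_subsemigroups = 57
    \<and> card lower_monoids = 57
    \<and> (\<forall>S\<in>lower_monoids. is_monoid S)
    \<and> is_group (sg_span {\<sigma> 0}) \<and> is_group (sg_span {\<sigma> 1})
    \<and> is_monoid (sg_span {\<sigma> 1, \<sigma> 6}) \<and> is_monoid (sg_span {\<sigma> 1, \<sigma> 2})
    \<and> card (iso_type ` subsemigroups) = 56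
    \<and> card (iso_type ` lower_subsemigroups) = 28
    \<and> card (iso_type ` lower_monoids - iso_type ` lower_subsemigroups) = 26
    \<and> iso_type ` subsemigroups = iso_type ` lower_subsemigroups \<union> iso_type ` lower_monoids
        \<union> {iso_type (sg_span {\<sigma> 1, \<sigma> 6}), iso_type (sg_span {\<sigma> 1, \<sigma> 2})}"
  by (intro conjI sg_span_3_4 sg_span_1_2 card_subsemigroups subsemigroups_partition
      card_lower_subsemigroups card_lower_monoids is_monoid_lower_monoids is_group_span_0_1
      is_monoid_spans card_iso_types iso_type_subsemigroups) simp

end
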